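(* Let $(G,\sigma)$ be a connected signed graph whose underlying graph $G$ has girth $g$. Then $r(G,\sigma)\geq g-2$. Moreover, equality $r(G,\sigma)=g-2$ holds if and only if $(G,\sigma)$ is one of the following: (a) a balanced complete bipartite signed graph with $g=4$; (b) a balanced signed cycle with $g\equiv 0 \pmod 4$; (c) an unbalanced signed cycle with $g\equiv 2 \pmod 4$.
   Context: Graphs are finite and simple. A signed graph $(G,\sigma)$ is a simple graph $G$ (the underlying graph) together with a map $\sigma:E(G)\to\{+,-\}$. Its adjacency matrix $A(G,\sigma)=(a^{\sigma}_{ij})$ has $a^{\sigma}_{ij}=\sigma(v_iv_j)$ if $v_iv_j\in E(G)$ and $0$ otherwise; the rank $r(G,\sigma)$ is the rank of $A(G,\sigma)$. The sign of a cycle is the product of the signs of its edges; a cycle is positive/negative accordingly, and a signed graph is balanced if all its cycles are positive, unbalanced otherwise. The girth $g$ of $G$ is the length of a shortest cycle of $G$ (so $G$ contains a cycle). *)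

theory Defs
  imports "HOL-Analysis.Analysis"
begin

text \<open>
  The vertex set of a graph is the whole finite type \<open>'v\<close>, so that its adjacency matrix is a
  square matrix indexed by \<open>'v\<close>; an edge is an unordered pair of vertices, i.e. a two-element set.
\<close>

definition simple_graph :: "'v::finite set set \<Rightarrow> bool" where
  "simple_graph E \<longleftrightarrow> (\<forall>e\<in>E. card e = 2)"

text \<open>The signs \<open>+\<close> and \<open>-\<close> are the reals 1 and -1; the values of \<open>\<sigma>\<close> off \<open>E\<close> are irrelevant.\<close>

definition signed_graph :: "'v::finite set set \<Rightarrow> ('v set \<Rightarrow> real) \<Rightarrow> bool" where
  "signed_graph E \<sigma> \<longleftrightarrow> simple_graph E \<and> (\<forall>e\<in>E. \<sigma> e \<in> {1, -1})"

definition adjacency_matrix :: "'v::finite set set \<Rightarrow> ('v set \<Rightarrow> real) \<Rightarrow> real^'v^'v" where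
  "adjacency_matrix E \<sigma> = (\<chi> i j. if {i, j} \<in> E then \<sigma> {i, j} else 0)"

definition connected_graph :: "'v::finite set set \<Rightarrow> bool" where
  "connected_graph E \<longleftrightarrow> (\<forall>u v. (u, v) \<in> {(x, y). {x, y} \<in> E}\<^sup>*)"

text \<open>
  A cycle is given by the list of its vertices in cyclic order, without repeating the first one
  at the end.
\<close>

definition cycle_edges :: "'v list \<Rightarrow> 'v set set" where
  "cycle_edges c = {{c ! i, c ! (Suc i mod length c)} | i. i < length c}"

definition is_cycle :: "'v::finite set set \<Rightarrow> 'v list \<Rightarrow> bool" where
  "is_cycle E c \<longleftrightarrow> 3 \<le> length c \<and> distinct c \<and> cycle_edges c \<subseteq> E"

text \<open>Only meaningful for graphs containing a cycle.\<close>

definition girth :: "'v::finite set set \<Rightarrow> nat" where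
  "girth E = (LEAST n. \<exists>c. is_cycle E c \<and> length c = n)"

definition cycle_sign :: "('v set \<Rightarrow> real) \<Rightarrow> 'v list \<Rightarrow> real" where
  "cycle_sign \<sigma> c = (\<Prod>e\<in>cycle_edges c. \<sigma> e)"

definition balanced :: "'v::finite set set \<Rightarrow> ('v set \<Rightarrow> real) \<Rightarrow> bool" where
  "balanced E \<sigma> \<longleftrightarrow> (\<forall>c. is_cycle E c \<longrightarrow> cycle_sign \<sigma> c = 1)"

definition complete_bipartite :: "'v::finite set set \<Rightarrow> bool" where
  "complete_bipartite E \<longleftrightarrow>
     (\<exists>X Y. X \<noteq> {} \<and> Y \<noteq> {} \<and> X \<inter> Y = {} \<and> X \<union> Y = UNIV \<and> E = {{x, y} | x y. x \<in> X \<and> y \<in> Y})"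

definition cycle_graph :: "'v::finite set set \<Rightarrow> bool" where
  "cycle_graph E \<longleftrightarrow> (\<exists>c. is_cycle E c \<and> set c = UNIV \<and> cycle_edges c = E)"

end

theory Submission
  imports Defs
begin

text \<open>
  An induced walk on \<open>k + 1\<close> vertices gives \<open>k\<close> rows in triangular position. A shortest cycle has no
  chords, so dropping one of its vertices leaves such a walk and the rank is at least \<open>g - 2\<close>. If
  \<open>g \<ge> 5\<close> and some vertex lies off the cycle, then one adjacent to the cycle prolongs the walk;
  hence equality forces \<open>G\<close> to be the cycle. On a cycle with edge signs \<open>a\<^sub>i\<close> the relations between
  the rows are the \<open>g\<close>-periodic solutions of \<open>z\<^sub>i\<^sub>+\<^sub>2 = - a\<^sub>i a\<^sub>i\<^sub>+\<^sub>1 z\<^sub>i\<close>, and they form a plane exactly when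
  \<open>g\<close> is even and the product of all the signs is \<open>(-1)\<^sup>g\<^sup>/\<^sup>2\<close>. If \<open>g = 4\<close> and the rank is \<open>2\<close>, then
  the rows of the two ends of one edge determine the whole matrix.
\<close>

section \<open>Induced walks and the rank\<close>

text \<open>The earlier vectors lie in the hyperplane where coordinate \<open>q k\<close> vanishes
  and \<open>v k\<close> does not, so \<open>v k\<close> is outside their span. Injectivity is
  recorded so that the image can be counted.\<close>

lemma independent_triangular:
  fixes v :: "nat \<Rightarrow> real^'n"
  assumes "\<And>i. i < k \<Longrightarrow> v i $ q i \<noteq> 0" "\<And>i j. j < i \<Longrightarrow> i < k \<Longrightarrow> v j $ q i = 0"
  shows "independent (v ` {..<k}) \<and> inj_on v {..<k}"
  using assms
proof (induction k)
  case 0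
  show ?case using independent_empty by simp
next
  case (Suc k)
  have IH: "independent (v ` {..<k})" "inj_on v {..<k}"
    using Suc by auto
  have "v ` {..<k} \<subseteq> {x. x $ q k = 0}"
    using Suc.prems(2) by auto
  moreover have "subspace {x::real^'n. x $ q k = 0}"
    by (simp add: subspace_def)
  ultimately have "span (v ` {..<k}) \<subseteq> {x. x $ q k = 0}"
    by (rule span_minimal)
  then have notin: "v k \<notin> span (v ` {..<k})"
    using Suc.prems(1)[of k] by auto
  then have "independent (insert (v k) (v ` {..<k}))"
    using IH(1) by (simp add: independent_insertI)
  moreover have "v k \<notin> v ` {..<k}"
    using notin by (metis span_base)
  then have "inj_on v {..<Suc k}"
    using IH(2) by (simp add: lessThan_Suc)
  ultimately show ?case
    by (simp only: lessThan_Suc image_insert simp_thms)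
qed

text \<open>Row \<open>p i\<close> has its pivot in column \<open>p (Suc i)\<close>, where all
  earlier rows vanish. Vertices may repeat, which admits the walk u, v, u along a single
  edge.\<close>

lemma induced_walk_rows_independent:
  fixes A :: "real^'n^'n"
  assumes "\<And>i. i < k \<Longrightarrow> A $ p i $ p (Suc i) \<noteq> 0"
    and "\<And>i j. Suc i < j \<Longrightarrow> j \<le> k \<Longrightarrow> A $ p i $ p j = 0"
  shows "independent ((\<lambda>i. A $ p i) ` {..<k}) \<and> inj_on (\<lambda>i. A $ p i) {..<k}"
  by (rule independent_triangular[where q = "\<lambda>i. p (Suc i)"]) (use assms in auto)

lemma rank_ge_induced_walk:
  fixes A :: "real^'n^'n"
  assumes "\<And>i. i < k \<Longrightarrow> A $ p i $ p (Suc i) \<noteq> 0"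
    and "\<And>i j. Suc i < j \<Longrightarrow> j \<le> k \<Longrightarrow> A $ p i $ p j = 0"
  shows "k \<le> rank A"
proof -
  have ind: "independent ((\<lambda>i. A $ p i) ` {..<k})" and inj: "inj_on (\<lambda>i. A $ p i) {..<k}"
    using induced_walk_rows_independent[of k A p] assms by auto
  have "card ((\<lambda>i. A $ p i) ` {..<k}) \<le> dim (rows A)"
    by (rule independent_card_le_dim[OF _ ind]) (auto simp: rows_def row_def vec_nth_inverse)
  then show ?thesis
    using inj by (simp add: card_image row_rank_def)
qed

lemma rank_le_card_span:
  fixes A :: "real^'n^'m"
  assumes "finite S" "\<And>i. A $ i \<in> span S"
  shows "rank A \<le> card S"
proof -
  have "rows A \<subseteq> span S"
    using assms(2) by (auto simp: rows_def row_def vec_nth_inverse)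
  then show ?thesis
    using assms(1) by (simp add: row_rank_def dim_le_card)
qed

section \<open>Entries of a signed adjacency matrix\<close>

lemma adjacency_matrix_nonzero_iff:
  assumes "signed_graph E \<sigma>"
  shows "adjacency_matrix E \<sigma> $ i $ j \<noteq> 0 \<longleftrightarrow> {i, j} \<in> E"
  using assms by (force simp: adjacency_matrix_def signed_graph_def)

lemma adjacency_matrix_square:
  assumes "signed_graph E \<sigma>" "{i, j} \<in> E"
  shows "adjacency_matrix E \<sigma> $ i $ j * adjacency_matrix E \<sigma> $ i $ j = 1"
  using assms by (force simp: adjacency_matrix_def signed_graph_def)

lemma adjacency_matrix_sym: "adjacency_matrix E \<sigma> $ i $ j = adjacency_matrix E \<sigma> $ j $ i"
  by (simp add: adjacency_matrix_def insert_commute)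

lemma no_loop: "signed_graph E \<sigma> \<Longrightarrow> {i, i} \<notin> E"
  by (force simp: signed_graph_def simple_graph_def)

section \<open>Cycles\<close>

text \<open>A cyclic order is handled through an \<open>n\<close>-periodic enumeration, which makes
  rotating a cycle a shift of the argument.\<close>

definition cyclic_enum :: "nat \<Rightarrow> (nat \<Rightarrow> 'v) \<Rightarrow> bool" where
  "cyclic_enum n p \<longleftrightarrow> 3 \<le> n \<and> (\<forall>i j. p i = p j \<longleftrightarrow> i mod n = j mod n)"

lemma cyclic_enum_eq_iff: "cyclic_enum n p \<Longrightarrow> p i = p j \<longleftrightarrow> i mod n = j mod n"
  by (simp add: cyclic_enum_def)

lemma cyclic_enum_ge3: "cyclic_enum n p \<Longrightarrow> 3 \<le> n"
  by (simp add: cyclic_enum_def)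

lemma cyclic_enum_period: "cyclic_enum n p \<Longrightarrow> p (i + n) = p i"
  by (simp add: cyclic_enum_def)

lemma cyclic_enum_shift:
  assumes "cyclic_enum n p"
  shows "cyclic_enum n (\<lambda>i. p (i + m))"
proof -
  \<comment> \<open>Congruence is spelled out with multiples of \<open>n\<close> added on both
    sides, so that \<open>m\<close> cancels without subtraction.\<close>
  have "i + m + n * q = j + m + n * r \<longleftrightarrow> i + n * q = j + n * r" for i j q r
    by linarith
  then have "(i + m) mod n = (j + m) mod n \<longleftrightarrow> i mod n = j mod n" for i j
    by (simp only: nat_mod_eq_iff)
  then show ?thesis
    using assms by (simp add: cyclic_enum_def)
qed

lemma cyclic_enum_inj: "cyclic_enum n p \<Longrightarrow> inj_on p {..<n}"
  by (auto simp: inj_on_def cyclic_enum_def)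

lemma cyclic_enum_range: "cyclic_enum n p \<Longrightarrow> range p = p ` {..<n}"
proof -
  assume p: "cyclic_enum n p"
  have "p i = p (i mod n)" "i mod n < n" for i
    using cyclic_enum_eq_iff[OF p, of i "i mod n"] cyclic_enum_ge3[OF p] by auto
  then show ?thesis
    by (metis image_subsetI image_eqI lessThan_iff subset_antisym top_greatest image_mono)
qed

text \<open>Otherwise \<open>n\<close> would divide 2, against \<open>3 \<le> n\<close>. Thus the
  two neighbours of a vertex along the cycle are different.\<close>

lemma cyclic_enum_neq_Suc_Suc:
  assumes "cyclic_enum n p"
  shows "p i \<noteq> p (Suc (Suc i))"
proof
  assume "p i = p (Suc (Suc i))"
  then have "i mod n = Suc (Suc i) mod n"
    using assms by (simp add: cyclic_enum_def)
  then have "n dvd Suc (Suc i) - i"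
    by (metis mod_eq_dvd_iff_nat le_SucI le_refl)
  then show False
    using assms by (auto simp: cyclic_enum_def dest: dvd_imp_le)
qed

lemma cyclic_enum_pred:
  assumes "cyclic_enum n p"
  obtains j where "p i = p (Suc j)"
proof
  \<comment> \<open>One step back is n - 1 steps forward, which also works at i = 0.\<close>
  show "p i = p (Suc (i + n - 1))"
    using assms by (simp add: cyclic_enum_def)
qed

text \<open>Coinciding edges with different first ends would be traversed in opposite directions,
  which forces \<open>p j = p (Suc (Suc j))\<close>. This turns the product over the edge set in
  \<open>cycle_sign\<close> into a product over indices.\<close>

lemma cyclic_enum_edge_inj:
  assumes "cyclic_enum n p"
  shows "inj_on (\<lambda>i. {p i, p (Suc i)}) {..<n}"
proof (rule inj_onI)
  fix i j assume ij: "i \<in> {..<n}" "j \<in> {..<n}" and eq: "{p i, p (Suc i)} = {p j, p (Suc j)}"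
  have "p i = p j"
  proof (rule ccontr)
    assume "p i \<noteq> p j"
    then have "p i = p (Suc j)" "p (Suc i) = p j"
      using eq by (auto simp: doubleton_eq_iff)
    then have "p j = p (Suc (Suc j))"
      using assms unfolding cyclic_enum_def by (metis mod_Suc_eq)
    then show False
      using cyclic_enum_neq_Suc_Suc[OF assms] by blast
  qed
  then show "i = j"
    using ij assms by (simp add: cyclic_enum_def)
qed

abbreviation cyclic_nth :: "'v list \<Rightarrow> nat \<Rightarrow> 'v" where
  "cyclic_nth c i \<equiv> c ! (i mod length c)"

lemma cyclic_enum_nth:
  assumes "3 \<le> length c" "distinct c"
  shows "cyclic_enum (length c) (cyclic_nth c)"
proof -
  have "i mod length c < length c" for i
    using assms by (intro mod_less_divisor) linarith
  then show ?thesis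
    using assms by (simp add: cyclic_enum_def nth_eq_iff_index_eq)
qed

lemma set_eq_range_cyclic_nth:
  assumes "c \<noteq> []"
  shows "set c = range (cyclic_nth c)"
proof -
  have "cyclic_nth c i \<in> set c" for i
    using assms by simp
  then show ?thesis
    by (auto simp: in_set_conv_nth image_iff) (metis mod_less)
qed

lemma cycle_edges_eq_range:
  assumes "c \<noteq> []"
  shows "cycle_edges c = range (\<lambda>i. {cyclic_nth c i, cyclic_nth c (Suc i)})"
proof -
  have m: "i mod length c < length c" for i
    using assms by simp
  have "{cyclic_nth c i, cyclic_nth c (Suc i)} \<in> cycle_edges c" for i
    unfolding cycle_edges_def using m[of i] by (auto simp: mod_Suc_eq intro!: exI[of _ "i mod length c"])
  moreover have "cycle_edges c \<subseteq> range (\<lambda>i. {cyclic_nth c i, cyclic_nth c (Suc i)})"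
    unfolding cycle_edges_def by (auto simp: image_iff) (metis mod_less)
  ultimately show ?thesis by blast
qed

lemma cycle_sign_eq_prod:
  assumes "3 \<le> length c" "distinct c"
  shows "cycle_sign \<sigma> c = (\<Prod>i<length c. \<sigma> {cyclic_nth c i, cyclic_nth c (Suc i)})"
proof -
  let ?e = "\<lambda>i. {cyclic_nth c i, cyclic_nth c (Suc i)}"
  have "cycle_edges c = ?e ` {..<length c}"
    unfolding cycle_edges_def by auto
  then show ?thesis
    unfolding cycle_sign_def
    using prod.reindex[OF cyclic_enum_edge_inj[OF cyclic_enum_nth[OF assms]], of \<sigma>] by simp
qed

section \<open>Shortest cycles\<close>

text \<open>\<open>p\<close> is read on its first \<open>n\<close> arguments only, so that a piece
  of a longer walk closed up by an extra edge can be plugged in.\<close>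

lemma girth_le:
  assumes "3 \<le> n" "inj_on p {..<n}" "\<And>i. Suc i < n \<Longrightarrow> {p i, p (Suc i)} \<in> E"
    and "{p (n - 1), p 0} \<in> E"
  shows "girth E \<le> n"
proof -
  have "is_cycle E (map p [0..<n])"
  proof -
    have "{p i, map p [0..<n] ! (Suc i mod n)} \<in> E" if "i < n" for i
    proof (cases "Suc i < n")
      case True
      then show ?thesis using assms(3) by simp
    next
      case False
      then have "i = n - 1" "Suc i = n" using that by auto
      then show ?thesis using assms(1,4) by simp
    qed
    then have "cycle_edges (map p [0..<n]) \<subseteq> E"
      by (auto simp: cycle_edges_def)
    then show ?thesis
      using assms(1,2) by (auto simp: is_cycle_def distinct_map lessThan_atLeast0)
  qed
  then show ?thesis
    unfolding girth_def by (intro Least_le exI[of _ "map p [0..<n]"]) auto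
qed

lemma shortest_cycle:
  assumes "\<exists>c. is_cycle E c"
  obtains c where "is_cycle E c" "length c = girth E"
proof -
  have "\<exists>n c. is_cycle E c \<and> length c = n"
    using assms by auto
  then have "\<exists>c. is_cycle E c \<and> length c = girth E"
    unfolding girth_def by (rule LeastI_ex)
  then show ?thesis
    using that by blast
qed

lemma cyclic_nth_edge:
  assumes "is_cycle E c"
  shows "{cyclic_nth c i, cyclic_nth c (Suc i)} \<in> E"
proof -
  have "c \<noteq> []" "cycle_edges c \<subseteq> E"
    using assms by (auto simp: is_cycle_def)
  then show ?thesis
    using cycle_edges_eq_range[of c] by blast
qed

lemma is_cycle_cyclic_enum: "is_cycle E c \<Longrightarrow> cyclic_enum (length c) (cyclic_nth c)"
  by (simp add: is_cycle_def cyclic_enum_nth)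

text \<open>The edge between \<open>p i\<close> and \<open>p j\<close> closes the walk from index i
  to index j into a cycle on j - i + 1 vertices, distinct because j < n.\<close>

lemma girth_le_walk_segment:
  assumes p: "cyclic_enum n p" "\<And>i. {p i, p (Suc i)} \<in> E"
    and ij: "Suc i < j" "j < n" and e: "{p i, p j} \<in> E"
  shows "girth E \<le> Suc (j - i)"
proof (rule girth_le[where p = "\<lambda>l. p (i + l)"])
  have "inj_on p ((\<lambda>l. i + l) ` {..<Suc (j - i)})"
    by (rule inj_on_subset[OF cyclic_enum_inj[OF p(1)]]) (use ij in auto)
  then show "inj_on (\<lambda>l. p (i + l)) {..<Suc (j - i)}"
    by (auto simp: inj_on_def)
  show "{p (i + (Suc (j - i) - 1)), p (i + 0)} \<in> E"
    using ij e by (simp add: insert_commute)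
qed (use p ij in auto)

text \<open>A chord cuts off a cycle on j - i + 1 vertices. This number reaches the girth only for
  the first and last index, whose edge is the closing edge of the cycle itself.\<close>

lemma shortest_cycle_chordless:
  assumes p: "cyclic_enum (girth E) p" "\<And>i. {p i, p (Suc i)} \<in> E"
    and ij: "Suc i < j" "j < girth E" "{p i, p j} \<in> E"
  shows "i = 0 \<and> j = girth E - 1"
  using girth_le_walk_segment[OF p ij] ij by linarith

text \<open>Stopping the walk at index g - 2 leaves out the closing edge, the one exception to
  chordlessness, and gives g - 2 independent rows.\<close>

lemma girth_le_rank_add_2:
  assumes "signed_graph E \<sigma>" and p: "cyclic_enum (girth E) p" "\<And>i. {p i, p (Suc i)} \<in> E"
  shows "girth E - 2 \<le> rank (adjacency_matrix E \<sigma>)"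
proof (rule rank_ge_induced_walk[where p = p])
  show "adjacency_matrix E \<sigma> $ p i $ p (Suc i) \<noteq> 0" for i
    using p(2) by (simp add: adjacency_matrix_nonzero_iff[OF assms(1)])
  fix i j assume "Suc i < j" "j \<le> girth E - 2"
  then have "{p i, p j} \<notin> E"
    using shortest_cycle_chordless[OF p, of i j] cyclic_enum_ge3[OF p(1)] by linarith
  then show "adjacency_matrix E \<sigma> $ p i $ p j = 0"
    by (simp add: adjacency_matrix_def)
qed

text \<open>The induced walk is u, v, u: its only condition at distance two is a zero on the
  diagonal.\<close>

lemma rank_ge_2:
  assumes "signed_graph E \<sigma>" "{u, v} \<in> E"
  shows "2 \<le> rank (adjacency_matrix E \<sigma>)"
proof (rule rank_ge_induced_walk[where p = "\<lambda>i. if i = 1 then v else u"])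
  fix i j :: nat assume "Suc i < j" "j \<le> 2"
  then have "i = 0 \<and> j = 2" by auto
  then show "adjacency_matrix E \<sigma> $ (if i = 1 then v else u) $ (if j = 1 then v else u) = 0"
    using no_loop[OF assms(1)] by (simp add: adjacency_matrix_def)
qed (use assms in \<open>auto simp: adjacency_matrix_nonzero_iff insert_commute\<close>)

section \<open>Vertices off a shortest cycle\<close>

lemma connected_graph_closed_set:
  assumes "connected_graph E" "u \<in> S" "\<And>x y. x \<in> S \<Longrightarrow> {x, y} \<in> E \<Longrightarrow> y \<in> S"
  shows "S = UNIV"
proof -
  have "v \<in> S" for v
  proof -
    have "(u, v) \<in> {(x, y). {x, y} \<in> E}\<^sup>*"
      using assms(1) by (simp add: connected_graph_def)
    then show ?thesis
      by (induction rule: rtrancl_induct) (use assms in auto)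
  qed
  then show ?thesis by blast
qed

text \<open>The induced walk is v, p 0, ..., p (g - 2). An edge from v to \<open>p k\<close> with k
  at least 1 would close a cycle on k + 2 vertices, so k = g - 2; but then v, p (g - 2), p (g - 1),
  p 0 is a 4-cycle, against girth at least 5.\<close>

lemma girth_le_rank_add_1:
  assumes "signed_graph E \<sigma>" and p: "cyclic_enum (girth E) p" "\<And>i. {p i, p (Suc i)} \<in> E"
    and "girth E \<ge> 5" and v: "v \<notin> range p" "{v, p 0} \<in> E"
  shows "girth E - 1 \<le> rank (adjacency_matrix E \<sigma>)"
proof (rule rank_ge_induced_walk[where p = "\<lambda>i. case i of 0 \<Rightarrow> v | Suc k \<Rightarrow> p k"])
  let ?q = "\<lambda>i. case i of 0 \<Rightarrow> v | Suc k \<Rightarrow> p k"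
  have vp: "v \<noteq> p i" for i
    using v(1) by auto
  show "adjacency_matrix E \<sigma> $ ?q i $ ?q (Suc i) \<noteq> 0" for i
    using p(2) v(2) by (auto simp: adjacency_matrix_nonzero_iff[OF assms(1)] split: nat.split)
  fix i j assume ij: "Suc i < j" "j \<le> girth E - 1"
  then obtain k where k: "j = Suc k" by (cases j) auto
  have "{?q i, ?q j} \<notin> E"
  proof (cases i)
    case (Suc l)
    then show ?thesis
      using shortest_cycle_chordless[OF p, of l k] ij k by force
  next
    case 0
    show ?thesis
    proof
      assume "{?q i, ?q j} \<in> E"
      then have e: "{v, p k} \<in> E" using 0 k by simp
      have kg: "1 \<le> k" "k \<le> girth E - 2" using ij k 0 by auto
      have inj: "inj_on ?q {..<Suc (Suc l)}" if "l < girth E" for l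
      proof (rule inj_onI)
        fix x y assume "x \<in> {..<Suc (Suc l)}" "y \<in> {..<Suc (Suc l)}" "?q x = ?q y"
        then show "x = y"
          using that vp vp[symmetric] inj_onD[OF cyclic_enum_inj[OF p(1)], of "x - 1" "y - 1"]
          by (cases x; cases y) simp_all
      qed
      have le: "girth E \<le> Suc (Suc k)"
      proof (rule girth_le[OF _ inj])
        show "{?q i, ?q (Suc i)} \<in> E" for i
          using p(2) v(2) by (cases i) auto
      qed (use e kg in \<open>auto simp: insert_commute\<close>)
      then have kk: "k = girth E - 2" "Suc (Suc k) = girth E" using kg by auto
      \<comment> \<open>Index g wraps round to 0, so \<open>p (Suc k)\<close> is the last vertex of
        the cycle.\<close>
      have "p (Suc (Suc k)) = p 0"
        using p(1) kk by (simp add: cyclic_enum_def)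
      then have last: "{p (Suc k), p 0} \<in> E"
        using p(2)[of "Suc k"] by simp
      have "girth E \<le> 4"
      proof (rule girth_le[where p = "\<lambda>i. [v, p k, p (Suc k), p 0] ! i"])
        have "p k \<noteq> p (Suc k)" "p k \<noteq> p 0" "p (Suc k) \<noteq> p 0"
          using kk kg p(1) \<open>girth E \<ge> 5\<close> by (auto simp: cyclic_enum_def)
        then have "distinct [v, p k, p (Suc k), p 0]"
          using vp by auto
        then show "inj_on (\<lambda>i. [v, p k, p (Suc k), p 0] ! i) {..<4}"
          by (intro inj_on_nth) auto
        fix i :: nat assume "Suc i < 4"
        then have "i = 0 \<or> i = 1 \<or> i = 2" by auto
        then show "{[v, p k, p (Suc k), p 0] ! i, [v, p k, p (Suc k), p 0] ! Suc i} \<in> E"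
          using e p(2) last by auto
      qed (use v(2) in \<open>auto simp: insert_commute\<close>)
      then show False using \<open>girth E \<ge> 5\<close> by simp
    qed
  qed
  then show "adjacency_matrix E \<sigma> $ ?q i $ ?q j = 0"
    by (simp add: adjacency_matrix_def)
qed

text \<open>A vertex off the cycle but adjacent to it would raise the rank to g - 1. So the cycle is
  closed under adjacency and, by connectedness, contains every vertex; any further edge would be a
  chord.\<close>

lemma cycle_graph_if_rank_eq:
  assumes "signed_graph E \<sigma>" "connected_graph E" "is_cycle E c" "length c = girth E"
    and "girth E \<ge> 5" "rank (adjacency_matrix E \<sigma>) = girth E - 2"
  shows "set c = UNIV \<and> cycle_edges c = E"
proof -
  let ?p = "cyclic_nth c"
  have c: "c \<noteq> []"
    using assms by auto
  have p: "cyclic_enum (girth E) ?p" "\<And>i. {?p i, ?p (Suc i)} \<in> E"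
    using is_cycle_cyclic_enum[OF assms(3)] cyclic_nth_edge[OF assms(3)] assms(4) by auto
  have univ: "range ?p = UNIV"
  proof (rule connected_graph_closed_set[OF assms(2)])
    show "?p 0 \<in> range ?p" by blast
    fix x y assume "x \<in> range ?p" and e: "{x, y} \<in> E"
    then obtain m where m: "x = ?p m" by blast
    show "y \<in> range ?p"
    proof (rule ccontr)
      assume y: "y \<notin> range ?p"
      \<comment> \<open>Rotating the cycle by \<open>m\<close> puts the vertex of attachment
        \<open>x\<close> at index 0.\<close>
      have "girth E - 1 \<le> rank (adjacency_matrix E \<sigma>)"
      proof (rule girth_le_rank_add_1[OF assms(1)])
        show "cyclic_enum (girth E) (\<lambda>i. ?p (i + m))"
          by (rule cyclic_enum_shift[OF p(1)])
        show "{?p (i + m), ?p (Suc i + m)} \<in> E" for i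
          using p(2)[of "i + m"] by simp
        show "y \<notin> range (\<lambda>i. ?p (i + m))"
          using y by blast
        show "{y, ?p (0 + m)} \<in> E"
          using e m by (simp add: insert_commute)
      qed (rule assms(5))
      then show False
        using assms(5,6) by linarith
    qed
  qed
  have "E \<subseteq> cycle_edges c"
  proof
    fix e assume "e \<in> E"
    have aux: "{?p i, ?p j} \<in> cycle_edges c" if "i < j" "j < girth E" "{?p i, ?p j} \<in> E" for i j
    proof (cases "Suc i < j")
      case True
      have "i = 0 \<and> j = girth E - 1"
        using shortest_cycle_chordless[OF p True that(2,3)] .
      \<comment> \<open>The exceptional pair is the closing edge: \<open>Suc j\<close> is the girth
        and wraps round to 0.\<close>
      then have "?p i = ?p (Suc j)"
        using assms(4,5) by simp
      then show ?thesis
        unfolding cycle_edges_eq_range[OF c] by (metis (no_types, lifting) insert_commute rangeI)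
    next
      case False
      then have "j = Suc i" using that by simp
      then show ?thesis
        unfolding cycle_edges_eq_range[OF c] by blast
    qed
    have "card e = 2"
      using assms(1) \<open>e \<in> E\<close> by (simp add: signed_graph_def simple_graph_def)
    then obtain x y where e: "e = {x, y}" "x \<noteq> y"
      by (auto simp: card_2_iff)
    have "x \<in> ?p ` {..<girth E}" "y \<in> ?p ` {..<girth E}"
      using univ cyclic_enum_range[OF p(1)] by auto
    then obtain i j where ij: "i < girth E" "j < girth E" "x = ?p i" "y = ?p j" by blast
    then have "i < j \<or> j < i"
      using e(2) by (metis linorder_neqE_nat)
    then show "e \<in> cycle_edges c"
      using aux[of i j] aux[of j i] ij e(1) \<open>e \<in> E\<close> by (auto simp: insert_commute)
  qed
  then show ?thesis
    using assms(3) univ set_eq_range_cyclic_nth[OF c] by (auto simp: is_cycle_def)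
qed

section \<open>The rank of a signed cycle\<close>

lemma cyclic_enum_Suc_eq_iff:
  assumes "cyclic_enum n p"
  shows "p (Suc i) = p (Suc j) \<longleftrightarrow> p i = p j"
  using cyclic_enum_eq_iff[OF cyclic_enum_shift[OF assms, of 1], of i j]
    cyclic_enum_eq_iff[OF assms, of i j] by simp

text \<open>The vertex is indexed by \<open>Suc i\<close> so that its predecessor is
  \<open>p i\<close> and no truncated subtraction occurs.\<close>

lemma cycle_neighbours:
  assumes p: "cyclic_enum n p" and E: "E = range (\<lambda>i. {p i, p (Suc i)})"
  shows "{p (Suc i), w} \<in> E \<longleftrightarrow> w = p i \<or> w = p (Suc (Suc i))"
proof
  assume "{p (Suc i), w} \<in> E"
  then obtain j where "{p (Suc i), w} = {p j, p (Suc j)}"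
    using E by auto
  then consider "p (Suc i) = p j" "w = p (Suc j)" | "p (Suc i) = p (Suc j)" "w = p j"
    by (auto simp: doubleton_eq_iff)
  then show "w = p i \<or> w = p (Suc (Suc i))"
    using cyclic_enum_Suc_eq_iff[OF p, of "Suc i" j] cyclic_enum_Suc_eq_iff[OF p, of i j]
    by cases simp_all
next
  assume "w = p i \<or> w = p (Suc (Suc i))"
  then show "{p (Suc i), w} \<in> E"
    using E by (auto simp: insert_commute)
qed

text \<open>Column \<open>p (Suc i)\<close> is supported on the two neighbours. By symmetry the
  second coefficient is written as the sign of the next edge, so that the vanishing of the
  combination becomes the two-step recurrence.\<close>

lemma cycle_row_combination:
  assumes "signed_graph E \<sigma>" and p: "cyclic_enum n p" and E: "E = range (\<lambda>i. {p i, p (Suc i)})"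
  defines "A \<equiv> adjacency_matrix E \<sigma>"
  shows "(\<Sum>w\<in>UNIV. x w * A $ w $ p (Suc i)) =
    x (p i) * A $ p i $ p (Suc i) + x (p (Suc (Suc i))) * A $ p (Suc i) $ p (Suc (Suc i))"
proof -
  have "(\<Sum>w\<in>UNIV. x w * A $ w $ p (Suc i)) = (\<Sum>w\<in>{p i, p (Suc (Suc i))}. x w * A $ w $ p (Suc i))"
  proof (rule sum.mono_neutral_right)
    show "\<forall>w\<in>UNIV - {p i, p (Suc (Suc i))}. x w * A $ w $ p (Suc i) = 0"
      using cycle_neighbours[OF p E, of i]
      by (auto simp: A_def adjacency_matrix_def insert_commute)
  qed auto
  also have "\<dots> = x (p i) * A $ p i $ p (Suc i) + x (p (Suc (Suc i))) * A $ p (Suc (Suc i)) $ p (Suc i)"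
    using cyclic_enum_neq_Suc_Suc[OF p, of i] by simp
  finally show ?thesis
    using adjacency_matrix_sym[of E \<sigma> "p (Suc (Suc i))" "p (Suc i)"] by (simp add: A_def)
qed

section \<open>Periodic sequences and the two-step recurrence\<close>

lemma periodic_mod:
  fixes z :: "nat \<Rightarrow> 'a"
  assumes "\<And>i. z (i + n) = z i"
  shows "z (i mod n) = z i"
proof -
  have "z (j + n * k) = z j" for j k
  proof (induction k)
    case (Suc k)
    then show ?case
      using assms[of "j + n * k"] by (simp add: ac_simps)
  qed simp
  from this[of "i mod n" "i div n"] show ?thesis
    by simp
qed

text \<open>\<open>p i\<close> determines \<open>i mod n\<close>, so a periodic sequence descends to
  a function of the vertices. Row combinations are summed over vertices, while the recurrence runs
  over indices.\<close>

lemma cyclic_enum_lift: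
  assumes p: "cyclic_enum n p" and z: "\<And>i. z (i + n) = z i"
  obtains x where "\<And>i. x (p i) = z i"
proof
  fix i
  have "i mod n < n"
    using cyclic_enum_ge3[OF p] by simp
  moreover have "p i = p (i mod n)"
    using cyclic_enum_eq_iff[OF p] by simp
  ultimately have "inv_into {..<n} p (p i) = i mod n"
    using inv_into_f_f[OF cyclic_enum_inj[OF p], of "i mod n"] by simp
  then show "(\<lambda>w. z (inv_into {..<n} p w)) (p i) = z i"
    using periodic_mod[of z n i, OF z] by simp
qed

lemma sum_cyclic_enum:
  fixes f :: "'v::finite \<Rightarrow> 'a::comm_monoid_add"
  assumes "cyclic_enum n p" "range p = UNIV"
  shows "(\<Sum>w\<in>UNIV. f w) = (\<Sum>i<n. f (p i))"
  using sum.reindex[OF cyclic_enum_inj[OF assms(1)], of f] cyclic_enum_range[OF assms(1)] assms(2)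
  by simp

lemma prod_periodic:
  fixes a :: "nat \<Rightarrow> real"
  assumes "\<And>i. a (i + n) = a i"
  shows "(\<Prod>j<i + n. a j) = (\<Prod>j<n. a j) * (\<Prod>j<i. a j)"
  by (induction i) (simp_all add: assms)

text \<open>The factors collected in k double steps are a quotient of two partial products of
  \<open>a\<close>; the denominator is moved to the left-hand side.\<close>

lemma two_step_recurrence:
  fixes a y :: "nat \<Rightarrow> real"
  assumes "\<And>i. y (Suc (Suc i)) = - a i * a (Suc i) * y i"
  shows "y (i + 2 * k) * (\<Prod>j<i. a j) = (- 1) ^ k * (\<Prod>j<i + 2 * k. a j) * y i"
proof (induction k)
  case (Suc k)
  have "y (i + 2 * Suc k) * (\<Prod>j<i. a j) =
      - a (i + 2 * k) * a (Suc (i + 2 * k)) * (y (i + 2 * k) * (\<Prod>j<i. a j))"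
    using assms[of "i + 2 * k"] by simp
  then show ?case
    unfolding Suc.IH by simp
qed simp

text \<open>By the recurrence every coordinate of the combination has a factor 1 - a * a with a an
  edge sign, hence vanishes.\<close>

lemma cycle_row_relation:
  assumes "signed_graph E \<sigma>" and p: "cyclic_enum n p" and univ: "range p = UNIV"
    and E: "E = range (\<lambda>i. {p i, p (Suc i)})"
  defines "A \<equiv> adjacency_matrix E \<sigma>"
  assumes z: "\<And>i. z (i + n) = z i"
    and rec: "\<And>i. z (Suc (Suc i)) = - (A $ p i $ p (Suc i)) * A $ p (Suc i) $ p (Suc (Suc i)) * z i"
  shows "(\<Sum>i<n. z i *\<^sub>R A $ p i) = 0"
proof -
  obtain x where x: "\<And>i. x (p i) = z i"
    using cyclic_enum_lift[of n p z, OF p z] by blast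
  have "(\<Sum>w\<in>UNIV. x w *\<^sub>R A $ w) $ c = 0" for c
  proof -
    obtain i' where "c = p i'"
      using univ by (metis rangeE UNIV_I)
    then obtain i where i: "c = p (Suc i)"
      using cyclic_enum_pred[OF p, of i'] by auto
    have "{p (Suc i), p (Suc (Suc i))} \<in> E"
      using E by blast
    then have sq: "A $ p (Suc i) $ p (Suc (Suc i)) * A $ p (Suc i) $ p (Suc (Suc i)) = 1"
      unfolding A_def by (rule adjacency_matrix_square[OF assms(1)])
    have "(\<Sum>w\<in>UNIV. x w *\<^sub>R A $ w) $ c = (\<Sum>w\<in>UNIV. x w * A $ w $ p (Suc i))"
      by (simp add: i)
    also have "\<dots> = z i * A $ p i $ p (Suc i) + z (Suc (Suc i)) * A $ p (Suc i) $ p (Suc (Suc i))"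
      unfolding A_def using cycle_row_combination[OF assms(1) p E] x by simp
    also have "\<dots> = z i * A $ p i $ p (Suc i) *
        (1 - A $ p (Suc i) $ p (Suc (Suc i)) * A $ p (Suc i) $ p (Suc (Suc i)))"
      unfolding rec by (simp add: algebra_simps)
    finally show ?thesis
      by (simp add: sq)
  qed
  then have "(\<Sum>w\<in>UNIV. x w *\<^sub>R A $ w) = 0"
    by (simp add: vec_eq_iff)
  then show ?thesis
    unfolding sum_cyclic_enum[OF p univ] x .
qed

text \<open>The sign condition makes a nowhere zero solution of the recurrence periodic. As n is
  even, it splits into an even and an odd part, two relations that express the last two rows by the
  first n - 2.\<close>

lemma rank_cycle_le:
  assumes "signed_graph E \<sigma>" and p: "cyclic_enum n p" and univ: "range p = UNIV"
    and E: "E = range (\<lambda>i. {p i, p (Suc i)})"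
  defines "A \<equiv> adjacency_matrix E \<sigma>"
  assumes n: "even n" and sgn: "(- 1) ^ (n div 2) * (\<Prod>i<n. A $ p i $ p (Suc i)) = 1"
  shows "rank A \<le> n - 2"
proof -
  define a where "a i = A $ p i $ p (Suc i)" for i
  have "{p i, p (Suc i)} \<in> E" for i
    using E by blast
  then have a0: "a i \<noteq> 0" for i
    by (simp add: a_def A_def adjacency_matrix_nonzero_iff[OF assms(1)])
  have aper: "a (i + n) = a i" for i
    using cyclic_enum_period[OF p, of i] cyclic_enum_period[OF p, of "Suc i"] by (simp add: a_def)
  \<comment> \<open>The solution of the recurrence with \<open>y 0 = 1\<close> and
    \<open>y 1 = a 0\<close>: each double step contributes two signs and a factor -1.\<close>
  define y where "y i = (- 1) ^ (i div 2) * (\<Prod>j<i. a j)" for i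
  have y0: "y i \<noteq> 0" for i
    using a0 by (simp add: y_def)
  have yrec: "y (Suc (Suc i)) = - a i * a (Suc i) * y i" for i
    by (simp add: y_def)
  have yper: "y (i + n) = y i" for i
  proof -
    have "(i + n) div 2 = i div 2 + n div 2"
      using n by presburger
    then have "y (i + n) = ((- 1) ^ (n div 2) * (\<Prod>i<n. a i)) * y i"
      unfolding y_def prod_periodic[of a n, OF aper] by (simp add: power_add)
    then show ?thesis
      using sgn by (simp add: a_def)
  qed
  define m where "m = n - 2"
  have m: "n = Suc (Suc m)"
    using cyclic_enum_ge3[OF p] by (simp add: m_def)
  then have "even m"
    using n by simp
  let ?S = "(\<lambda>i. A $ p i) ` {..<m}"
  have in_span: "A $ p (m + r) \<in> span ?S" if "r < 2" for r
  proof -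
    \<comment> \<open>The recurrence links indices of equal parity only, and n is even, so one
      parity class of \<open>y\<close> is again a periodic solution. Since m is even, class
      \<open>r\<close> involves row \<open>m + r\<close> but not the other one of the last two
      rows.\<close>
    define z where "z i = (if i mod 2 = r then y i else 0)" for i
    have "(\<Sum>i<n. z i *\<^sub>R A $ p i) = 0"
      unfolding A_def
    proof (rule cycle_row_relation[OF assms(1) p univ E])
      show "z (i + n) = z i" for i
      proof -
        have "(i + n) mod 2 = i mod 2"
          using n by presburger
        then show ?thesis
          by (simp add: z_def yper)
      qed
      show "z (Suc (Suc i)) = - (adjacency_matrix E \<sigma> $ p i $ p (Suc i)) *
          adjacency_matrix E \<sigma> $ p (Suc i) $ p (Suc (Suc i)) * z i" for i
        using yrec[of i] by (simp add: z_def a_def A_def)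
    qed
    then have "(\<Sum>i<m. z i *\<^sub>R A $ p i) + z m *\<^sub>R A $ p m + z (Suc m) *\<^sub>R A $ p (Suc m) = 0"
      by (simp add: m)
    moreover have "z m *\<^sub>R A $ p m + z (Suc m) *\<^sub>R A $ p (Suc m) = y (m + r) *\<^sub>R A $ p (m + r)"
    proof -
      have "m mod 2 = 0" "Suc m mod 2 = 1"
        using \<open>even m\<close> by presburger+
      moreover have "r = 0 \<or> r = 1"
        using that by auto
      ultimately show ?thesis
        by (auto simp: z_def)
    qed
    ultimately have "y (m + r) *\<^sub>R A $ p (m + r) = - (\<Sum>i<m. z i *\<^sub>R A $ p i)"
      by (simp only: add.assoc eq_neg_iff_add_eq_0) (simp only: add.commute)
    also have "\<dots> \<in> span ?S"
      by (intro span_neg span_sum span_scale span_base) auto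
    finally show ?thesis
      using span_scale[of "y (m + r) *\<^sub>R A $ p (m + r)" ?S "inverse (y (m + r))"] y0[of "m + r"]
      by simp
  qed
  have "rank A \<le> card ?S"
  proof (rule rank_le_card_span)
    fix v
    have "v \<in> p ` {..<n}"
      using univ cyclic_enum_range[OF p] by simp
    then obtain i where i: "i < n" "v = p i" by blast
    show "A $ v \<in> span ?S"
    proof (cases "i < m")
      case True
      then show ?thesis using i by (auto intro: span_base)
    next
      case False
      then show ?thesis using in_span[of "i - m"] i m by simp
    qed
  qed simp
  also have "\<dots> \<le> m"
    using card_image_le[of "{..<m}"] by simp
  finally show ?thesis
    by (simp add: m)
qed

text \<open>The first n - 2 rows span the row space, so the next row depends on them; this gives a
  periodic solution with value 1 at n - 2 and 0 at n - 1. For odd n, double steps lead from that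
  zero to that one, a contradiction. For even n, a full turn from n - 2 must reproduce the value 1,
  which fixes the product of the signs.\<close>

lemma rank_cycle_eq_imp:
  assumes "signed_graph E \<sigma>" and p: "cyclic_enum n p" and univ: "range p = UNIV"
    and E: "E = range (\<lambda>i. {p i, p (Suc i)})" and "girth E = n"
  defines "A \<equiv> adjacency_matrix E \<sigma>"
  assumes rk: "rank A = n - 2"
  shows "even n \<and> (- 1) ^ (n div 2) * (\<Prod>i<n. A $ p i $ p (Suc i)) = 1"
proof -
  define a where "a i = A $ p i $ p (Suc i)" for i
  have asq: "a i * a i = 1" for i
    using E unfolding a_def A_def by (intro adjacency_matrix_square[OF assms(1)]) blast
  have a0: "a i \<noteq> 0" for i
    using asq[of i] by auto
  have aper: "a (i + n) = a i" for i
    using cyclic_enum_period[OF p, of i] cyclic_enum_period[OF p, of "Suc i"] by (simp add: a_def)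
  have pE: "{p i, p (Suc i)} \<in> E" for i
    using E by blast
  define m where "m = n - 2"
  have m: "n = Suc (Suc m)" "m \<ge> 1"
    using cyclic_enum_ge3[OF p] by (auto simp: m_def)
  let ?f = "\<lambda>i. A $ p i"
  have ind: "independent (?f ` {..<m})" and inj: "inj_on ?f {..<m}"
  proof -
    have "A $ p i $ p j = 0" if "Suc i < j" "j \<le> m" for i j
    proof -
      have "{p i, p j} \<notin> E"
        using shortest_cycle_chordless[of E p i j] p pE that m assms(5) by auto
      then show ?thesis
        by (simp add: A_def adjacency_matrix_def)
    qed
    then show "independent (?f ` {..<m})" "inj_on ?f {..<m}"
      using induced_walk_rows_independent[of m A p] a0 by (auto simp: a_def)
  qed
  have "rows A \<subseteq> span (?f ` {..<m})"
  proof (rule card_ge_dim_independent[OF _ ind])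
    show "?f ` {..<m} \<subseteq> rows A"
      by (auto simp: rows_def row_def vec_nth_inverse)
    show "dim (rows A) \<le> card (?f ` {..<m})"
      using rk m by (simp add: card_image[OF inj] row_rank_def)
  qed
  then have "?f m \<in> span (?f ` {..<m})"
    by (auto simp: rows_def row_def vec_nth_inverse)
  then obtain u where "?f m = (\<Sum>v\<in>?f ` {..<m}. u v *\<^sub>R v)"
    by (auto simp: span_finite)
  then have u: "?f m = (\<Sum>i<m. u (?f i) *\<^sub>R ?f i)"
    by (simp add: sum.reindex[OF inj])
  \<comment> \<open>The coefficients of the relation, extended periodically: 1 for row
    \<open>m\<close> and 0 for the last row, \<open>Suc m\<close>, which does not enter.\<close>
  define z where "z i = (let k = i mod n in if k < m then - u (?f k) else if k = m then 1 else 0)" for i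
  have zper: "z (i + n) = z i" for i
    by (simp add: z_def)
  have zm: "z m = 1" "z (Suc m) = 0"
    using m by (auto simp: z_def)
  have rel: "(\<Sum>i<n. z i *\<^sub>R ?f i) = 0"
  proof -
    have "(\<Sum>i<n. z i *\<^sub>R ?f i) = (\<Sum>i<m. z i *\<^sub>R ?f i) + ?f m"
      using zm by (simp add: m)
    also have "(\<Sum>i<m. z i *\<^sub>R ?f i) = - (\<Sum>i<m. u (?f i) *\<^sub>R ?f i)"
      using m by (simp add: z_def sum_negf)
    finally show ?thesis
      using u by simp
  qed
  obtain x where x: "\<And>i. x (p i) = z i"
    using cyclic_enum_lift[of n p z, OF p zper] by blast
  have rec: "z (Suc (Suc i)) = - a i * a (Suc i) * z i" for i
  proof -
    have "0 = (\<Sum>i<n. z i *\<^sub>R ?f i) $ p (Suc i)"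
      using rel by simp
    also have "\<dots> = (\<Sum>w\<in>UNIV. x w * A $ w $ p (Suc i))"
      unfolding sum_cyclic_enum[OF p univ] x by simp
    also have "\<dots> = z i * a i + z (Suc (Suc i)) * a (Suc i)"
      unfolding A_def a_def using cycle_row_combination[OF assms(1) p E] x by simp
    finally have "z (Suc (Suc i)) * a (Suc i) = - (z i * a i)"
      by linarith
    then have "z (Suc (Suc i)) * (a (Suc i) * a (Suc i)) = - (z i * a i) * a (Suc i)"
      by (simp flip: mult.assoc)
    then show ?thesis
      by (simp add: asq mult.commute mult.left_commute)
  qed
  note iter = two_step_recurrence[of z a, OF rec]
  have P0: "(\<Prod>j<i. a j) \<noteq> 0" for i
    using a0 by simp
  have even: "even n"
  proof (rule ccontr)
    assume "odd n"
    then obtain k where k: "n = Suc (2 * k)"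
      by (auto elim: oddE)
    \<comment> \<open>The 2k = n - 1 steps from \<open>Suc m\<close> stop one short of a full turn,
      at an index congruent to \<open>m\<close>.\<close>
    then have eq: "Suc m + 2 * k = m + n" by simp
    have "z (Suc m + 2 * k) = 1"
      unfolding eq by (simp add: zper zm)
    then show False
      using iter[of "Suc m" k] P0[of "Suc m"] zm by simp
  qed
  then obtain k where k: "n = 2 * k"
    by (auto elim: evenE)
  have "(\<Prod>j<m. a j) = (- 1) ^ k * ((\<Prod>j<n. a j) * (\<Prod>j<m. a j))"
    using iter[of m k] zper[of m] zm prod_periodic[of a n m, OF aper] by (simp add: k)
  then have "(- 1) ^ k * (\<Prod>j<n. a j) = 1"
    using P0[of m] by simp
  then show ?thesis
    using even k by (simp add: a_def)
qed

text \<open>Every vertex has just two neighbours, and a cycle through it uses two distinct ones,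
  hence both. So the vertices of \<open>q\<close> are closed under adjacency, and \<open>q\<close>
  exhausts all vertices and edges.\<close>

lemma cycle_in_cycle_graph:
  assumes "connected_graph E" and p: "cyclic_enum n p" and univ: "range p = UNIV"
    and E: "E = range (\<lambda>i. {p i, p (Suc i)})"
    and q: "cyclic_enum k q" "\<And>i. {q i, q (Suc i)} \<in> E"
  shows "k = n \<and> E = range (\<lambda>i. {q i, q (Suc i)})"
proof -
  have nb: "y = q j \<or> y = q (Suc (Suc j))" if "{q (Suc j), y} \<in> E" for j y
  proof -
    obtain i' where "q (Suc j) = p i'"
      using univ by (metis rangeE UNIV_I)
    then obtain i where i: "q (Suc j) = p (Suc i)"
      using cyclic_enum_pred[OF p, of i'] by auto
    have "{p (Suc i), q j} \<in> E" "{p (Suc i), q (Suc (Suc j))} \<in> E"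
      using q(2)[of j] q(2)[of "Suc j"] i by (simp_all add: insert_commute)
    then show ?thesis
      using that i cyclic_enum_neq_Suc_Suc[OF q(1), of j]
      unfolding cycle_neighbours[OF p E, of i] by (auto simp: cycle_neighbours[OF p E, of i])
  qed
  have "range q = UNIV"
  proof (rule connected_graph_closed_set[OF assms(1)])
    show "q 0 \<in> range q" by blast
    fix x y assume "x \<in> range q" and e: "{x, y} \<in> E"
    then obtain j' where "x = q j'" by blast
    then obtain j where "x = q (Suc j)"
      using cyclic_enum_pred[OF q(1), of j'] by auto
    then show "y \<in> range q"
      using nb[of j y] e by auto
  qed
  then have "card (q ` {..<k}) = card (p ` {..<n})"
    using univ cyclic_enum_range[OF p] cyclic_enum_range[OF q(1)] by simp
  then have "k = n"
    using cyclic_enum_inj[OF p] cyclic_enum_inj[OF q(1)] by (simp add: card_image)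
  moreover have "E \<subseteq> range (\<lambda>i. {q i, q (Suc i)})"
  proof
    fix e assume "e \<in> E"
    then obtain i where e: "e = {p i, p (Suc i)}"
      using E by blast
    obtain j' where "p i = q j'"
      using \<open>range q = UNIV\<close> by (metis rangeE UNIV_I)
    then obtain j where j: "p i = q (Suc j)"
      using cyclic_enum_pred[OF q(1), of j'] by auto
    have "p (Suc i) = q j \<or> p (Suc i) = q (Suc (Suc j))"
      using nb[of j] \<open>e \<in> E\<close> e j by simp
    then show "e \<in> range (\<lambda>i. {q i, q (Suc i)})"
      using e j by (auto simp: insert_commute)
  qed
  ultimately show ?thesis
    using q(2) by blast
qed

text \<open>All cycles share one length and one edge set, so girth and balance can be read off the
  given cycle.\<close>

lemma cycle_graph_sign:
  assumes "connected_graph E" and c: "is_cycle E c" "set c = UNIV" "cycle_edges c = E"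
  shows "girth E = length c" and "balanced E \<sigma> \<longleftrightarrow> cycle_sign \<sigma> c = 1"
proof -
  have ne: "c' \<noteq> []" if "is_cycle E c'" for c'
    using that by (auto simp: is_cycle_def)
  have univ: "range (cyclic_nth c) = UNIV" and E: "E = range (\<lambda>i. {cyclic_nth c i, cyclic_nth c (Suc i)})"
    using c(2,3) set_eq_range_cyclic_nth[OF ne[OF c(1)]] cycle_edges_eq_range[OF ne[OF c(1)]] by simp_all
  have other: "length c' = length c \<and> cycle_edges c' = E" if c': "is_cycle E c'" for c'
    using cycle_in_cycle_graph[OF assms(1) is_cycle_cyclic_enum[OF c(1)] univ E
        is_cycle_cyclic_enum[OF c'] cyclic_nth_edge[OF c']]
      cycle_edges_eq_range[OF ne[OF c']] by simp
  obtain c0 where "is_cycle E c0" "length c0 = girth E"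
    using shortest_cycle c(1) by metis
  then show "girth E = length c"
    using other by metis
  show "balanced E \<sigma> \<longleftrightarrow> cycle_sign \<sigma> c = 1"
    using other c by (auto simp: balanced_def cycle_sign_def)
qed

text \<open>The product P of all signs is 1 or -1, and balance means P = 1. It remains to compare P
  with \<open>(- 1) ^ (n div 2)\<close> for even n, that is, to look at n modulo 4.\<close>

lemma cycle_graph_rank_iff:
  assumes "signed_graph E \<sigma>" "connected_graph E" "cycle_graph E"
  shows "rank (adjacency_matrix E \<sigma>) = girth E - 2 \<longleftrightarrow>
    (balanced E \<sigma> \<and> girth E mod 4 = 0) \<or> (\<not> balanced E \<sigma> \<and> girth E mod 4 = 2)"
proof -
  obtain c where c: "is_cycle E c" "set c = UNIV" "cycle_edges c = E"
    using assms(3) by (auto simp: cycle_graph_def)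
  let ?n = "girth E" and ?p = "cyclic_nth c" and ?A = "adjacency_matrix E \<sigma>"
  have len: "length c = ?n"
    using cycle_graph_sign(1)[OF assms(2) c] by simp
  have ne: "c \<noteq> []"
    using c(1) by (auto simp: is_cycle_def)
  have p: "cyclic_enum ?n ?p"
    using is_cycle_cyclic_enum[OF c(1)] len by simp
  have univ: "range ?p = UNIV" and E: "E = range (\<lambda>i. {?p i, ?p (Suc i)})"
    using c set_eq_range_cyclic_nth[OF ne] cycle_edges_eq_range[OF ne] by simp_all
  define P where "P = (\<Prod>i<?n. ?A $ ?p i $ ?p (Suc i))"
  have entry: "?A $ ?p i $ ?p (Suc i) = \<sigma> {?p i, ?p (Suc i)}" for i
    using cyclic_nth_edge[OF c(1), of i] by (simp add: adjacency_matrix_def)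
  have "cycle_sign \<sigma> c = (\<Prod>i<length c. \<sigma> {?p i, ?p (Suc i)})"
    by (rule cycle_sign_eq_prod) (use c(1) in \<open>auto simp: is_cycle_def\<close>)
  then have bal: "balanced E \<sigma> \<longleftrightarrow> P = 1"
    unfolding P_def entry len[symmetric] using cycle_graph_sign(2)[OF assms(2) c] by simp
  have "P * P = (\<Prod>i<?n. ?A $ ?p i $ ?p (Suc i) * ?A $ ?p i $ ?p (Suc i))"
    by (simp add: P_def prod.distrib)
  also have "\<dots> = 1"
    by (rule prod.neutral) (use adjacency_matrix_square[OF assms(1) cyclic_nth_edge[OF c(1)]] in blast)
  finally have P: "P = 1 \<or> P = -1"
    using square_eq_1_iff by blast
  have "?n - 2 \<le> rank ?A"
    by (rule girth_le_rank_add_2[OF assms(1) p cyclic_nth_edge[OF c(1)]])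
  then have "rank ?A = ?n - 2 \<longleftrightarrow> even ?n \<and> (- 1) ^ (?n div 2) * P = 1"
    using rank_cycle_le[OF assms(1) p univ E] rank_cycle_eq_imp[OF assms(1) p univ E refl]
    unfolding P_def by fastforce
  also have "\<dots> \<longleftrightarrow> (P = 1 \<and> ?n mod 4 = 0) \<or> (P \<noteq> 1 \<and> ?n mod 4 = 2)"
  \<comment> \<open>An even half leaves the residues 0 and 1 modulo 4, an odd one 2 and 3; evenness
    of the girth then selects 0 or 2.\<close>
  proof (cases "even (?n div 2)")
    case True
    then have "even ?n \<longleftrightarrow> ?n mod 4 = 0" "?n mod 4 \<noteq> 2"
      by presburger+
    then show ?thesis using True P by auto
  next
    case False
    then have "even ?n \<longleftrightarrow> ?n mod 4 = 2" "?n mod 4 \<noteq> 0"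
      by presburger+
    then show ?thesis using False P by auto
  qed
  finally show ?thesis
    by (simp add: bal)
qed

section \<open>Rank two\<close>

text \<open>The rows of u and v are independent and hence span the row space. The coefficients of
  row w are found in columns u and v, where one of the two spanning rows vanishes and the other is
  the sign of uv, its own inverse.\<close>

lemma rank_2_entry:
  assumes "signed_graph E \<sigma>" and uv: "{u, v} \<in> E"
  defines "A \<equiv> adjacency_matrix E \<sigma>"
  assumes "rank A = 2"
  shows "A $ w $ z = A $ u $ v * (A $ w $ v * A $ u $ z + A $ w $ u * A $ v $ z)"
proof -
  let ?p = "\<lambda>i::nat. if i = 1 then v else u"
  have loop: "A $ x $ x = 0" for x
    using no_loop[OF assms(1)] by (simp add: A_def adjacency_matrix_def)
  have sym: "A $ v $ u = A $ u $ v"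
    unfolding A_def by (rule adjacency_matrix_sym)
  have sq: "A $ u $ v * A $ u $ v = 1"
    unfolding A_def by (rule adjacency_matrix_square[OF assms(1) uv])
  have "independent ((\<lambda>i. A $ ?p i) ` {..<2}) \<and> inj_on (\<lambda>i. A $ ?p i) {..<2}"
  proof (rule induced_walk_rows_independent)
    show "A $ ?p i $ ?p (Suc i) \<noteq> 0" if "i < 2" for i
      using that sq sym by (cases "i = 0") auto
    fix i j :: nat assume "Suc i < j" "j \<le> 2"
    then have "i = 0 \<and> j = 2" by auto
    then show "A $ ?p i $ ?p j = 0"
      by (simp add: loop)
  qed
  moreover have img: "(\<lambda>i. A $ ?p i) ` {..<2} = {A $ u, A $ v}"
    by (auto simp: numeral_2_eq_2 lessThan_Suc)
  ultimately have "independent {A $ u, A $ v}" "card {A $ u, A $ v} = 2"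
    using card_image[of "\<lambda>i. A $ ?p i" "{..<2}"] by simp_all
  then have "rows A \<subseteq> span {A $ u, A $ v}"
    using assms(4) by (intro card_ge_dim_independent)
      (auto simp: rows_def row_def vec_nth_inverse row_rank_def)
  then have "A $ w \<in> span {A $ u, A $ v}"
    by (auto simp: rows_def row_def vec_nth_inverse)
  then obtain \<alpha> \<beta> where "A $ w - \<alpha> *\<^sub>R A $ u = \<beta> *\<^sub>R A $ v"
    by (auto simp: span_insert[of "A $ u"] span_singleton)
  then have w: "A $ w = \<alpha> *\<^sub>R A $ u + \<beta> *\<^sub>R A $ v"
    by (simp add: algebra_simps)
  have "A $ w $ v = \<alpha> * A $ u $ v" "A $ w $ u = \<beta> * A $ u $ v"
    by (simp_all add: w loop sym)
  then have "A $ u $ v * (A $ w $ v * A $ u $ z + A $ w $ u * A $ v $ z) =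
      (A $ u $ v * A $ u $ v) * (\<alpha> * A $ u $ z + \<beta> * A $ v $ z)"
    by (simp only:) (simp add: algebra_simps)
  then show ?thesis
    by (simp add: sq w)
qed

text \<open>\<open>s\<close> switches the signed graph to the all-positive one: around a cycle each
  vertex contributes its value of \<open>s\<close> twice.\<close>

lemma balanced_switching:
  assumes "\<And>x y. {x, y} \<in> E \<Longrightarrow> \<sigma> {x, y} = s x * s y" "\<And>x. s x * s x = (1::real)"
  shows "balanced E \<sigma>"
  unfolding balanced_def
proof (intro allI impI)
  fix c assume c: "is_cycle E c"
  let ?p = "cyclic_nth c"
  have "cycle_sign \<sigma> c = (\<Prod>i<length c. \<sigma> {?p i, ?p (Suc i)})"
    by (rule cycle_sign_eq_prod) (use c in \<open>auto simp: is_cycle_def\<close>)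
  also have "\<dots> = (\<Prod>i<length c. s (?p i)) * (\<Prod>i<length c. s (?p (Suc i)))"
    by (simp only: assms(1)[OF cyclic_nth_edge[OF c]] prod.distrib)
  \<comment> \<open>A cyclic index shift: the factor at the far end equals the one at index
    0.\<close>
  also have "(\<Prod>i<length c. s (?p (Suc i))) = (\<Prod>i<length c. s (?p i))"
  proof -
    obtain m where m: "length c = Suc m"
      using c by (cases "length c") (auto simp: is_cycle_def)
    have "(\<Prod>i<Suc m. s (?p (Suc i))) = s (?p (Suc m)) * (\<Prod>i<m. s (?p (Suc i)))"
      by simp
    also have "?p (Suc m) = ?p 0"
      using m by simp
    also have "s (?p 0) * (\<Prod>i<m. s (?p (Suc i))) = (\<Prod>i<Suc m. s (?p i))"
      by (simp add: prod.lessThan_Suc_shift del: prod.lessThan_Suc)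
    finally show ?thesis
      by (simp only: m)
  qed
  also have "(\<Prod>i<length c. s (?p i)) * (\<Prod>i<length c. s (?p i)) = 1"
    unfolding prod.distrib[symmetric] assms(2) by simp
  finally show "cycle_sign \<sigma> c = 1" .
qed

lemma girth_triangle:
  assumes "signed_graph E \<sigma>" "{x, y} \<in> E" "{y, z} \<in> E" "{z, x} \<in> E"
  shows "girth E \<le> 3"
proof (rule girth_le[where p = "\<lambda>i. [x, y, z] ! i"])
  have "distinct [x, y, z]"
    using assms no_loop[OF assms(1)] by auto
  then show "inj_on (\<lambda>i. [x, y, z] ! i) {..<3}"
    by (intro inj_on_nth) auto
  fix i :: nat assume "Suc i < 3"
  then have "i = 0 \<or> i = 1" by auto
  then show "{[x, y, z] ! i, [x, y, z] ! Suc i} \<in> E"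
    using assms by auto
qed (use assms in auto)

text \<open>The parts are the neighbours of v and those of u, disjoint since there is no triangle.
  For w in X the entry formula makes \<open>A $ w $ z\<close> a product of a factor in w and a
  factor in z: its support gives complete bipartiteness, its values a switching function.\<close>

lemma complete_bipartite_balanced_if_rank_2:
  assumes "signed_graph E \<sigma>" "connected_graph E" "girth E > 3" and uv: "{u, v} \<in> E"
    and rk: "rank (adjacency_matrix E \<sigma>) = 2"
  shows "complete_bipartite E \<and> balanced E \<sigma>"
proof -
  define A where "A = adjacency_matrix E \<sigma>"
  have nz: "A $ x $ y \<noteq> 0 \<longleftrightarrow> {x, y} \<in> E" for x y
    unfolding A_def by (rule adjacency_matrix_nonzero_iff[OF assms(1)])
  have sq: "{x, y} \<in> E \<Longrightarrow> A $ x $ y * A $ x $ y = 1" for x y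
    unfolding A_def by (rule adjacency_matrix_square[OF assms(1)])
  have entry: "A $ w $ z = A $ u $ v * (A $ w $ v * A $ u $ z + A $ w $ u * A $ v $ z)" for w z
    using rank_2_entry[OF assms(1) uv rk] unfolding A_def .
  define X where "X = {w. {w, v} \<in> E}"
  define Y where "Y = {w. {w, u} \<in> E}"
  have mem: "u \<in> X" "v \<in> Y"
    using uv by (auto simp: X_def Y_def insert_commute)
  have disj: "w \<in> X \<Longrightarrow> w \<in> Y \<Longrightarrow> False" for w
    using girth_triangle[OF assms(1) uv, of w] assms(3) by (auto simp: X_def Y_def insert_commute)
  have X: "w \<in> X \<longleftrightarrow> A $ w $ v \<noteq> 0" "w \<in> X \<longleftrightarrow> A $ v $ w \<noteq> 0" for w
    by (simp_all add: X_def nz insert_commute)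
  have Y: "w \<in> Y \<longleftrightarrow> A $ w $ u \<noteq> 0" "w \<in> Y \<longleftrightarrow> A $ u $ w \<noteq> 0" for w
    by (simp_all add: Y_def nz insert_commute)
  have univ: "X \<union> Y = UNIV"
  proof (rule connected_graph_closed_set[OF assms(2)])
    show "u \<in> X \<union> Y"
      using mem by blast
    \<comment> \<open>By the entry formula a vertex adjacent to neither u nor v has a zero row, so
      it cannot have a neighbour.\<close>
    fix x y assume "{x, y} \<in> E"
    then have "A $ y $ x \<noteq> 0"
      by (simp add: nz insert_commute)
    then show "y \<in> X \<union> Y"
      using entry[of y x] X(1) Y(1) by auto
  qed
  have entry_XY: "A $ w $ z = A $ u $ v * A $ w $ v * A $ u $ z" if "w \<in> X" for w z
  proof -
    have "A $ w $ u = 0"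
      using Y(1)[of w] disj[OF that] by blast
    then show ?thesis
      using entry[of w z] by simp
  qed
  have YX: "z \<in> X" if "w \<in> Y" "{w, z} \<in> E" for w z
    using entry[of w z] X[of w] X(2)[of z] disj[OF _ that(1)] that(2) nz[of w z] by auto
  have XY: "z \<in> Y" if "w \<in> X" "{w, z} \<in> E" for w z
    using entry_XY[OF that(1), of z] nz[of w z] that(2) Y(2)[of z] by auto
  have "E = {{x, y} |x y. x \<in> X \<and> y \<in> Y}"
  proof
    show "E \<subseteq> {{x, y} |x y. x \<in> X \<and> y \<in> Y}"
    proof
      fix e assume "e \<in> E"
      then have "card e = 2"
        using assms(1) by (simp add: signed_graph_def simple_graph_def)
      then obtain w z where e: "e = {w, z}"
        by (auto simp: card_2_iff)
      have "w \<in> X \<or> w \<in> Y"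
        using univ by blast
      then show "e \<in> {{x, y} |x y. x \<in> X \<and> y \<in> Y}"
        using XY[of w z] YX[of w z] \<open>e \<in> E\<close> e by (auto simp: insert_commute)
    qed
    show "{{x, y} |x y. x \<in> X \<and> y \<in> Y} \<subseteq> E"
    proof clarify
      fix x y assume xy: "x \<in> X" "y \<in> Y"
      then have "A $ x $ y \<noteq> 0"
        using entry_XY[OF xy(1), of y] X(1) Y(2) nz uv by auto
      then show "{x, y} \<in> E"
        by (simp add: nz)
    qed
  qed
  then have "complete_bipartite E"
    unfolding complete_bipartite_def using univ mem disj by blast
  moreover have "balanced E \<sigma>"
  \<comment> \<open>The two factors of \<open>entry_XY\<close>, the first used on X and the second
    off X.\<close>
  proof (rule balanced_switching[where s = "\<lambda>w. if w \<in> X then A $ u $ v * A $ w $ v else A $ u $ w"])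
    let ?s = "\<lambda>w. if w \<in> X then A $ u $ v * A $ w $ v else A $ u $ w"
    have *: "\<sigma> {x, y} = ?s x * ?s y" if "{x, y} \<in> E" "x \<in> X" for x y
    proof -
      have "y \<notin> X"
        using XY[OF that(2,1)] disj by blast
      moreover have "A $ x $ y = \<sigma> {x, y}"
        using that by (simp add: A_def adjacency_matrix_def)
      ultimately show ?thesis
        using entry_XY[OF that(2), of y] that(2) by simp
    qed
    show "\<sigma> {x, y} = ?s x * ?s y" if "{x, y} \<in> E" for x y
    proof (cases "x \<in> X")
      case False
      then have "y \<in> X"
        using univ YX that by blast
      then show ?thesis
        using *[of y x] that by (simp add: insert_commute mult.commute)
    qed (use * that in blast)
    show "?s x * ?s x = 1" for x
    proof (cases "x \<in> X")
      case True
      then have "{x, v} \<in> E"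
        by (simp add: X_def)
      have "?s x * ?s x = (A $ u $ v * A $ u $ v) * (A $ x $ v * A $ x $ v)"
        using True by simp
      also have "\<dots> = 1"
        unfolding sq[OF uv] sq[OF \<open>{x, v} \<in> E\<close>] by simp
      finally show ?thesis .
    next
      case False
      then have "{u, x} \<in> E"
        using univ by (auto simp: Y_def insert_commute)
      then show ?thesis
        using False sq by simp
    qed
  qed
  ultimately show ?thesis ..
qed

text \<open>Positive 4-cycles make the rows of any two vertices in the same part proportional, so
  one row from each part spans everything.\<close>

lemma rank_complete_bipartite_balanced_le:
  assumes "signed_graph E \<sigma>" "complete_bipartite E" "balanced E \<sigma>"
  shows "rank (adjacency_matrix E \<sigma>) \<le> 2"
proof -
  define A where "A = adjacency_matrix E \<sigma>"
  obtain X Y where XY: "X \<noteq> {}" "Y \<noteq> {}" "X \<inter> Y = {}" "X \<union> Y = UNIV"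
    and E: "E = {{x, y} | x y. x \<in> X \<and> y \<in> Y}"
    using assms(2) unfolding complete_bipartite_def by blast
  have edge: "{x, y} \<in> E" if "x \<in> X" "y \<in> Y" for x y
    using E that by blast
  have sq: "A $ x $ y * A $ x $ y = 1" if "x \<in> X" "y \<in> Y" for x y
    unfolding A_def by (rule adjacency_matrix_square[OF assms(1) edge[OF that]])
  have zero: "A $ x $ z = 0" if "x \<in> X \<and> z \<in> X \<or> x \<in> Y \<and> z \<in> Y" for x z
  proof -
    have "{x, z} \<notin> E"
      using that XY(3) unfolding E by (auto simp: doubleton_eq_iff)
    then show ?thesis
      by (simp add: A_def adjacency_matrix_def)
  qed
  have sym: "A $ x $ y = A $ y $ x" for x y
    unfolding A_def by (rule adjacency_matrix_sym)
  have four: "A $ x $ y = A $ x $ y' * A $ x' $ y' * A $ x' $ y"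
    if "x \<in> X" "x' \<in> X" "y \<in> Y" "y' \<in> Y" for x x' y y'
  \<comment> \<open>If two corners coincide, the identity only says that a sign squares to 1;
    otherwise the corners form a 4-cycle, positive by balance.\<close>
  proof (cases "x = x' \<or> y = y'")
    case True
    then show ?thesis
      using sq[OF that(1,4)] sq[OF that(2,4)] by (auto simp: mult.assoc)
  next
    case False
    let ?c = "[x, y, x', y']"
    have d: "distinct ?c"
      using False that XY(3) by auto
    have "cycle_edges ?c \<subseteq> E"
    proof
      have len: "length ?c = 4" by simp
      fix e assume "e \<in> cycle_edges ?c"
      then obtain i where i: "i < 4" "e = {?c ! i, ?c ! (Suc i mod 4)}"
        unfolding cycle_edges_def len by blast
      then have "i = 0 \<or> i = 1 \<or> i = 2 \<or> i = 3" by auto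
      then show "e \<in> E"
        using i that edge by (auto simp: insert_commute)
    qed
    then have "cycle_sign \<sigma> ?c = 1"
      using d assms(3) by (simp add: balanced_def is_cycle_def)
    moreover have "cycle_sign \<sigma> ?c = \<sigma> {x, y} * \<sigma> {y, x'} * \<sigma> {x', y'} * \<sigma> {y', x}"
    proof -
      have len: "length ?c = 4" by simp
      have prod4: "(\<Prod>i<4. f i) = f 0 * f 1 * f 2 * f 3" for f :: "nat \<Rightarrow> real"
        by (simp add: eval_nat_numeral)
      have "cycle_sign \<sigma> ?c = (\<Prod>i<4. \<sigma> {?c ! (i mod 4), ?c ! (Suc i mod 4)})"
        using cycle_sign_eq_prod[OF _ d, of \<sigma>] unfolding len by linarith
      then show ?thesis
        unfolding prod4 by simp
    qed
    moreover have "A $ x $ y = \<sigma> {x, y}" "A $ x' $ y = \<sigma> {y, x'}" "A $ x' $ y' = \<sigma> {x', y'}"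
      "A $ x $ y' = \<sigma> {y', x}"
      using that edge by (simp_all add: A_def adjacency_matrix_def insert_commute)
    ultimately have "A $ x $ y * (A $ x $ y' * A $ x' $ y' * A $ x' $ y) = 1"
      by (simp add: mult.commute mult.left_commute)
    then have "(A $ x $ y * A $ x $ y) * (A $ x $ y' * A $ x' $ y' * A $ x' $ y) = A $ x $ y"
      by (simp add: mult.assoc)
    then show ?thesis
      using sq[OF that(1,3)] by simp
  qed
  obtain x0 y0 where x0: "x0 \<in> X" and y0: "y0 \<in> Y"
    using XY by blast
  \<comment> \<open>The ratio of the two rows is read off in column \<open>y0\<close>;
    \<open>four\<close> carries it over to the other columns of Y.\<close>
  have rowX: "A $ x = (A $ x $ y0 * A $ x0 $ y0) *\<^sub>R A $ x0" if "x \<in> X" for x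
  proof (simp only: vec_eq_iff, rule allI)
    fix z
    show "A $ x $ z = ((A $ x $ y0 * A $ x0 $ y0) *\<^sub>R A $ x0) $ z"
    proof (cases "z \<in> X")
      case True
      then show ?thesis using that x0 zero by simp
    next
      case False
      then have "z \<in> Y" using XY(4) by blast
      then show ?thesis using four[OF that x0 _ y0, of z] by simp
    qed
  qed
  have rowY: "A $ y = (A $ x0 $ y0 * A $ x0 $ y) *\<^sub>R A $ y0" if "y \<in> Y" for y
  proof (simp only: vec_eq_iff, rule allI)
    fix z
    show "A $ y $ z = ((A $ x0 $ y0 * A $ x0 $ y) *\<^sub>R A $ y0) $ z"
    proof (cases "z \<in> Y")
      case True
      then show ?thesis using that y0 zero by simp
    next
      case False
      then have "z \<in> X" using XY(4) by blast
      then show ?thesis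
        using four[OF _ x0 that y0, of z] sym[of y z] sym[of y0 z] by simp
    qed
  qed
  have "A $ w \<in> span {A $ x0, A $ y0}" for w
  proof (cases "w \<in> X")
    case True
    have "(A $ w $ y0 * A $ x0 $ y0) *\<^sub>R A $ x0 \<in> span {A $ x0, A $ y0}"
      by (intro span_scale span_base) simp
    then show ?thesis
      using rowX[OF True] by metis
  next
    case False
    then have "w \<in> Y" using XY(4) by blast
    have "(A $ x0 $ y0 * A $ x0 $ w) *\<^sub>R A $ y0 \<in> span {A $ x0, A $ y0}"
      by (intro span_scale span_base) simp
    then show ?thesis
      using rowY[OF \<open>w \<in> Y\<close>] by metis
  qed
  then have "rank A \<le> card {A $ x0, A $ y0}"
    by (intro rank_le_card_span) auto
  also have "\<dots> \<le> 2"
    by (simp add: card_insert_if)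
  finally show ?thesis
    unfolding A_def .
qed

section \<open>The bound and the equality cases\<close>

theorem theorem3p2:
  fixes E :: "'v::finite set set" and \<sigma> :: "'v set \<Rightarrow> real" and g :: nat
  assumes "signed_graph E \<sigma>"
    and "connected_graph E"
    and "\<exists>c. is_cycle E c"
    and "g = girth E"
  shows "int (rank (adjacency_matrix E \<sigma>)) \<ge> int g - 2 \<and>
    (int (rank (adjacency_matrix E \<sigma>)) = int g - 2 \<longleftrightarrow>
       (complete_bipartite E \<and> balanced E \<sigma> \<and> g = 4) \<or>
       (cycle_graph E \<and> balanced E \<sigma> \<and> g mod 4 = 0) \<or>
       (cycle_graph E \<and> \<not> balanced E \<sigma> \<and> g mod 4 = 2))"
proof -
  let ?r = "rank (adjacency_matrix E \<sigma>)"
  obtain c where c: "is_cycle E c" "length c = girth E"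
    using shortest_cycle[OF assms(3)] by blast
  have p: "cyclic_enum (girth E) (cyclic_nth c)"
    using is_cycle_cyclic_enum[OF c(1)] c(2) by simp
  have g3: "g \<ge> 3"
    using cyclic_enum_ge3[OF p] assms(4) by simp
  have lower: "g - 2 \<le> ?r"
    using girth_le_rank_add_2[OF assms(1) p cyclic_nth_edge[OF c(1)]] assms(4) by simp
  have uv: "{cyclic_nth c 0, cyclic_nth c (Suc 0)} \<in> E"
    by (rule cyclic_nth_edge[OF c(1)])
  have ge2: "?r \<ge> 2"
    by (rule rank_ge_2[OF assms(1) uv])
  have cyc: "?r = g - 2 \<longleftrightarrow> (balanced E \<sigma> \<and> g mod 4 = 0) \<or> (\<not> balanced E \<sigma> \<and> g mod 4 = 2)"
    if "cycle_graph E"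
    using cycle_graph_rank_iff[OF assms(1,2) that] assms(4) by simp
  have "?r = g - 2 \<longleftrightarrow>
       (complete_bipartite E \<and> balanced E \<sigma> \<and> g = 4) \<or>
       (cycle_graph E \<and> balanced E \<sigma> \<and> g mod 4 = 0) \<or>
       (cycle_graph E \<and> \<not> balanced E \<sigma> \<and> g mod 4 = 2)" (is "_ \<longleftrightarrow> ?cases")
  proof
    assume eq: "?r = g - 2"
    \<comment> \<open>Rank at least 2 excludes g = 3, where g - 2 = 1.\<close>
    then consider "g = 4" | "g \<ge> 5"
      using ge2 by linarith
    then show ?cases
    proof cases
      case 1
      then show ?thesis
        using complete_bipartite_balanced_if_rank_2[OF assms(1,2) _ uv] eq assms(4) by simp
    next
      case 2
      then have "cycle_graph E"
        using cycle_graph_if_rank_eq[OF assms(1,2) c] eq c(1) assms(4)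
        by (auto simp: cycle_graph_def)
      then show ?thesis
        using cyc eq by blast
    qed
  next
    assume ?cases
    \<comment> \<open>The cycle cases are settled by \<open>cyc\<close>; in the bipartite one the
      rank is squeezed to 2 = g - 2.\<close>
    then have "(complete_bipartite E \<and> balanced E \<sigma> \<and> g = 4) \<or> ?r = g - 2"
      using cyc by auto
    then show "?r = g - 2"
      using rank_complete_bipartite_balanced_le[OF assms(1)] ge2 by auto
  qed
  \<comment> \<open>With g at least 3, truncated subtraction agrees with integer
    subtraction.\<close>
  moreover have "int ?r = int g - 2 \<longleftrightarrow> ?r = g - 2"
    using g3 by linarith
  ultimately show ?thesis
    using lower by linarith
qed

end
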